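(* Let $\Delta$ be a pure $d$-dimensional simplicial complex and let $\Gamma$ be any partition extender of $\Delta$. Then for every $0\le i\le d+1$, \[ h_i(\Delta)=\bigl|\{\text{intervals in a partitioning of }\Gamma\text{ with bottom element of size }i\}\bigr|-\bigl|\{\text{intervals in a partitioning of }(\Gamma,\Delta)\text{ with bottom element of size }i\}\bigr|, \] where any partitioning of $\Gamma$ and any partitioning of $(\Gamma,\Delta)$ may be used.
   Context: All simplicial complexes are finite: a simplicial complex is a collection $\Delta$ of finite subsets of a finite ground set, closed under taking subsets. Its elements are faces, maximal faces are facets, $\dim\sigma=|\sigma|-1$, $\dim\Delta$ is the maximal dimension of a face, and $\Delta$ is pure if all its facets have the same dimension. For a $d$-dimensional complex $\Delta$, $f_i(\Delta)$ is the number of $i$-dimensional faces ($-1\le i\le d$), and the $h$-vector $(h_0(\Delta),\dots,h_{d+1}(\Delta))$ is defined by \[ \sum_{i=0}^{d+1}f_{i-1}(\Delta)(x-1)^{d-i+1}=\sum_{i=0}^{d+1}h_i(\Delta)x^{d-i+1}. \] For a subcomplex $\Delta$ of a simplicial complex $\Gamma$, the relative complex $(\Gamma,\Delta)$ is the set of faces of $\Gamma$ not in $\Delta$. The face poset of a (relative) complex is its set of faces ordered by inclusion. An interval $[\sigma,\tau]=\{e : \sigma\le e\le\tau\}$ in a poset $P$ is Boolean if it is isomorphic to the poset of all subsets of a $k$-element set for some $k\ge 0$; its bottom element is $\sigma$. A partitioning of a poset $P$ is a decomposition of $P$ as a disjoint union of Boolean intervals, the maximum element of each of which is a maximal element of $P$;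 $P$ is partitionable if it has a partitioning. A partitioning of a (relative) complex means a partitioning of its face poset, and the (relative) complex is partitionable if one exists. A partition extender for a pure $d$-dimensional complex $\Delta$ is a pure $d$-dimensional complex $\Gamma\supseteq\Delta$ such that both $\Gamma$ and $(\Gamma,\Delta)$ are partitionable. *)

theory Defs
  imports "HOL-Computational_Algebra.Polynomial" "HOL-Library.Disjoint_Sets"
begin

section \<open>Posets and partitionings\<close>

text \<open>
  A poset is a set of elements of an ordered type, with the induced order. A family of faces is
  thereby its own face poset, since the order on sets is inclusion.
\<close>

definition maximal_elements :: "'b::order set \<Rightarrow> 'b set" where
  "maximal_elements P = {m \<in> P. \<forall>x\<in>P. m \<le> x \<longrightarrow> x = m}"

definition interval :: "'b::order set \<Rightarrow> 'b \<Rightarrow> 'b \<Rightarrow> 'b set" where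
  "interval P \<sigma> \<tau> = P \<inter> {\<sigma>..\<tau>}"

definition boolean_poset :: "'b::order set \<Rightarrow> bool" where
  "boolean_poset I \<longleftrightarrow>
     (\<exists>(k::nat) f. bij_betw f I (Pow {..<k}) \<and> (\<forall>x\<in>I. \<forall>y\<in>I. x \<le> y \<longleftrightarrow> f x \<subseteq> f y))"

definition partitioning :: "'b::order set \<Rightarrow> 'b set set \<Rightarrow> bool" where
  "partitioning P \<I> \<longleftrightarrow> partition_on P \<I> \<and>
     (\<forall>I\<in>\<I>. \<exists>\<sigma>\<in>P. \<exists>\<tau>\<in>P. \<sigma> \<le> \<tau> \<and> I = interval P \<sigma> \<tau> \<and> boolean_poset I \<and>
        \<tau> \<in> maximal_elements P)"

definition partitionable :: "'b::order set \<Rightarrow> bool" where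
  "partitionable P \<longleftrightarrow> (\<exists>\<I>. partitioning P \<I>)"

definition bottom :: "'b::order set \<Rightarrow> 'b" where
  "bottom I = (LEAST e. e \<in> I)"

lemma bottom_interval:
  assumes "\<sigma> \<in> P" "\<sigma> \<le> \<tau>"
  shows "bottom (interval P \<sigma> \<tau>) = \<sigma>"
  unfolding bottom_def interval_def using assms by (intro Least_equality) auto


section \<open>Simplicial complexes\<close>

text \<open>The finite ground set is left implicit: it may be any finite set containing \<open>\<Union>\<Delta>\<close>.\<close>

definition simplicial_complex :: "'a set set \<Rightarrow> bool" where
  "simplicial_complex \<Delta> \<longleftrightarrow>
     finite \<Delta> \<and> (\<forall>\<sigma>\<in>\<Delta>. finite \<sigma>) \<and> (\<forall>\<sigma>\<in>\<Delta>. \<forall>\<rho>. \<rho> \<subseteq> \<sigma> \<longrightarrow> \<rho> \<in> \<Delta>)"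

definition face_dim :: "'a set \<Rightarrow> int" where
  "face_dim \<sigma> = int (card \<sigma>) - 1"

abbreviation facets :: "'a set set \<Rightarrow> 'a set set" where
  "facets \<Delta> \<equiv> maximal_elements \<Delta>"

definition complex_dim :: "'a set set \<Rightarrow> int" where
  "complex_dim \<Delta> = Max (face_dim ` \<Delta>)"

text \<open>
  The void complex, which has no faces, is excluded because it has no dimension. The complex
  \<open>{{}}\<close> is allowed and has dimension \<open>-1\<close>.
\<close>

definition pure_complex :: "int \<Rightarrow> 'a set set \<Rightarrow> bool" where
  "pure_complex d \<Delta> \<longleftrightarrow> simplicial_complex \<Delta> \<and> \<Delta> \<noteq> {} \<and> complex_dim \<Delta> = d \<and>
     (\<forall>F\<in>facets \<Delta>. \<forall>G\<in>facets \<Delta>. face_dim F = face_dim G)"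

definition relative_complex :: "'a set set \<Rightarrow> 'a set set \<Rightarrow> 'a set set" where
  "relative_complex \<Gamma> \<Delta> = \<Gamma> - \<Delta>"

definition partition_extender :: "int \<Rightarrow> 'a set set \<Rightarrow> 'a set set \<Rightarrow> bool" where
  "partition_extender d \<Delta> \<Gamma> \<longleftrightarrow> pure_complex d \<Gamma> \<and> \<Delta> \<subseteq> \<Gamma> \<and>
     partitionable \<Gamma> \<and> partitionable (relative_complex \<Gamma> \<Delta>)"


section \<open>The h-vector\<close>

definition f_number :: "'a set set \<Rightarrow> int \<Rightarrow> nat" where
  "f_number \<Delta> i = card {\<sigma>\<in>\<Delta>. face_dim \<sigma> = i}"

definition h_poly :: "'a set set \<Rightarrow> int poly" where
  "h_poly \<Delta> = (let n = nat (complex_dim \<Delta> + 1) in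
     \<Sum>i\<le>n. smult (int (f_number \<Delta> (int i - 1))) ([:-1, 1:] ^ (n - i)))"

text \<open>
  With \<open>n = d + 1\<close>, the entry \<open>h\<^sub>i\<close> is the coefficient of \<open>x\<close> to the power \<open>n - i\<close>; it is
  meaningful for \<open>i \<le> n\<close> only. The two lemmas below say that these are precisely the numbers
  determined by the defining polynomial identity.
\<close>

definition h_vector :: "'a set set \<Rightarrow> nat \<Rightarrow> int" where
  "h_vector \<Delta> i = coeff (h_poly \<Delta>) (nat (complex_dim \<Delta> + 1) - i)"

lemma h_vector_identity:
  fixes \<Delta> :: "'a set set"
  defines "n \<equiv> nat (complex_dim \<Delta> + 1)"
  shows "(\<Sum>i\<le>n. smult (int (f_number \<Delta> (int i - 1))) ([:-1, 1:] ^ (n - i))) =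
         (\<Sum>i\<le>n. monom (h_vector \<Delta> i) (n - i))"
proof -
  have "degree (h_poly \<Delta>) \<le> n"
    unfolding h_poly_def Let_def n_def[symmetric]
    by (intro degree_sum_le) (auto intro!: order.trans[OF degree_smult_le]
        order.trans[OF degree_power_le])
  then have "h_poly \<Delta> = (\<Sum>i\<le>n. monom (coeff (h_poly \<Delta>) i) i)"
    by (simp add: poly_as_sum_of_monoms')
  also have "\<dots> = (\<Sum>i\<le>n. monom (h_vector \<Delta> i) (n - i))"
    by (rule sum.reindex_bij_witness[of _ "\<lambda>i. n - i" "\<lambda>i. n - i"])
       (auto simp: h_vector_def n_def)
  finally show ?thesis
    by (simp add: h_poly_def Let_def n_def)
qed

lemma h_vector_unique:
  fixes \<Delta> :: "'a set set" and g :: "nat \<Rightarrow> int"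
  defines "n \<equiv> nat (complex_dim \<Delta> + 1)"
  assumes g: "(\<Sum>i\<le>n. smult (int (f_number \<Delta> (int i - 1))) ([:-1, 1:] ^ (n - i))) =
         (\<Sum>i\<le>n. monom (g i) (n - i))" and i: "i \<le> n"
  shows "h_vector \<Delta> i = g i"
proof -
  have "h_vector \<Delta> i = coeff (\<Sum>j\<le>n. monom (g j) (n - j)) (n - i)"
    using g by (simp add: h_vector_def h_poly_def Let_def n_def)
  also have "\<dots> = (\<Sum>j\<le>n. if j = i then g j else 0)"
    unfolding coeff_sum using i by (intro sum.cong) auto
  also have "\<dots> = g i"
    using i by simp
  finally show ?thesis .
qed

end

theory Submission
  imports Defs
begin

text \<open>
  Fix \<open>n = d + 1\<close> and weight a face \<open>\<rho>\<close> by \<open>(x - 1)\<close> to the power \<open>n - |\<rho>|\<close>. Grouping faces by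
  size shows that the total weight of \<open>\<Delta>\<close> is the \<open>h\<close>-polynomial
  (\<open>h_poly_eq_sum_faces\<close>). By the binomial theorem, a full interval \<open>{\<sigma>..\<tau>}\<close> with \<open>|\<tau>| = n\<close> has
  total weight \<open>x\<close> to the power \<open>n - |\<sigma>|\<close> (\<open>sum_interval\<close>); so for any partitioning into such
  intervals, the total weight of the poset is the generating function of the bottom sizes
  (\<open>sum_partitioning\<close>). Both \<open>\<Gamma>\<close> and \<open>\<Gamma> - \<Delta>\<close> are families to which this applies: they are closed
  under passing to intermediate sets, and their maximal elements are facets of \<open>\<Gamma>\<close>, hence of
  size \<open>n\<close>. As weights are additive, the weight of \<open>\<Delta>\<close> is the weight of \<open>\<Gamma>\<close> minus that of
  \<open>\<Gamma> - \<Delta>\<close>, and comparing the coefficients of \<open>x\<close> to the power \<open>n - i\<close> gives the formula.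
\<close>

text \<open>
  Expanding the product of \<open>1 + (x - 1)\<close> over \<open>\<tau> - \<sigma>\<close>, the term in which \<open>1\<close> is chosen exactly on
  \<open>X\<close> is the weight of \<open>\<sigma> \<union> X\<close>.
\<close>

lemma sum_interval:
  fixes x :: "'b::comm_ring_1"
  assumes "finite \<tau>" "\<sigma> \<subseteq> \<tau>"
  shows "(\<Sum>\<rho>\<in>{\<sigma>..\<tau>}. (x - 1) ^ (card \<tau> - card \<rho>)) = x ^ (card \<tau> - card \<sigma>)"
proof -
  have fin: "finite \<sigma>"
    using assms finite_subset by blast
  have "x ^ (card \<tau> - card \<sigma>) = (\<Prod>a\<in>\<tau> - \<sigma>. 1 + (x - 1))"
    using assms fin by (simp add: card_Diff_subset)
  also have "\<dots> = (\<Sum>X\<in>Pow (\<tau> - \<sigma>). (\<Prod>a\<in>X. 1) * (\<Prod>a\<in>(\<tau> - \<sigma>) - X. x - 1))"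
    using assms by (intro prod_add) auto
  also have "\<dots> = (\<Sum>\<rho>\<in>{\<sigma>..\<tau>}. (x - 1) ^ (card \<tau> - card \<rho>))"
  proof (rule sum.reindex_bij_witness[of _ "\<lambda>\<rho>. \<rho> - \<sigma>" "\<lambda>X. \<sigma> \<union> X"])
    fix X assume X: "X \<in> Pow (\<tau> - \<sigma>)"
    then have "\<tau> - \<sigma> - X = \<tau> - (\<sigma> \<union> X)" "\<sigma> \<union> X \<subseteq> \<tau>"
      using assms by auto
    moreover have "finite (\<sigma> \<union> X)"
      using calculation(2) assms(1) finite_subset by blast
    ultimately show "(x - 1) ^ (card \<tau> - card (\<sigma> \<union> X)) = (\<Prod>a\<in>X. 1) * (\<Prod>a\<in>(\<tau> - \<sigma>) - X. x - 1)"
      by (simp add: card_Diff_subset)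
  qed (use assms in auto)
  finally show ?thesis ..
qed

text \<open>
  Under \<open>convex\<close>, the intervals of the poset \<open>P\<close> are full intervals of the Boolean lattice. This
  covers simplicial complexes and relative complexes at once.
\<close>

lemma sum_partitioning:
  fixes P :: "'a set set" and x :: "'b::comm_ring_1"
  assumes fin: "finite P" "\<And>\<sigma>. \<sigma> \<in> P \<Longrightarrow> finite \<sigma>"
    and convex: "\<And>\<sigma> \<rho> \<tau>. \<sigma> \<in> P \<Longrightarrow> \<tau> \<in> P \<Longrightarrow> \<sigma> \<subseteq> \<rho> \<Longrightarrow> \<rho> \<subseteq> \<tau> \<Longrightarrow> \<rho> \<in> P"
    and max: "\<And>\<tau>. \<tau> \<in> maximal_elements P \<Longrightarrow> card \<tau> = n"
    and part: "partitioning P \<I>"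
  shows "(\<Sum>\<rho>\<in>P. (x - 1) ^ (n - card \<rho>)) = (\<Sum>I\<in>\<I>. x ^ (n - card (bottom I)))"
proof -
  have on: "partition_on P \<I>"
    using part by (simp add: partitioning_def)
  have U: "\<Union>\<I> = P"
    using on by (simp add: partition_on_def)
  have "(\<Sum>\<rho>\<in>P. (x - 1) ^ (n - card \<rho>)) = (\<Sum>I\<in>\<I>. \<Sum>\<rho>\<in>I. (x - 1) ^ (n - card \<rho>))"
    unfolding U[symmetric]
  proof (rule sum.Union_disjoint[unfolded o_def])
    show "\<forall>I\<in>\<I>. finite I"
      using U fin(1) by (metis Union_upper finite_subset)
    show "\<forall>I\<in>\<I>. \<forall>J\<in>\<I>. I \<noteq> J \<longrightarrow> I \<inter> J = {}"
      using on by (auto simp: partition_on_def disjoint_def)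
  qed
  also have "\<dots> = (\<Sum>I\<in>\<I>. x ^ (n - card (bottom I)))"
  proof (rule sum.cong[OF refl])
    fix I assume "I \<in> \<I>"
    then obtain \<sigma> \<tau> where st: "\<sigma> \<in> P" "\<tau> \<in> P" "\<sigma> \<subseteq> \<tau>" "I = interval P \<sigma> \<tau>"
      "\<tau> \<in> maximal_elements P"
      using part by (auto simp: partitioning_def)
    have "{\<sigma>..\<tau>} \<subseteq> P"
      using convex[OF st(1,2)] by auto
    then have I: "I = {\<sigma>..\<tau>}"
      using st(4) by (simp add: interval_def Int_absorb1)
    have "bottom I = \<sigma>"
      unfolding st(4) using st(1,3) by (rule bottom_interval)
    moreover have "card \<tau> = n"
      using st(5) by (rule max)
    ultimately show "(\<Sum>\<rho>\<in>I. (x - 1) ^ (n - card \<rho>)) = x ^ (n - card (bottom I))"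
      using sum_interval[OF fin(2)[OF st(2)] st(3), of x] by (simp only: I)
  qed
  finally show ?thesis .
qed

lemma h_poly_eq_sum_faces:
  assumes "finite \<Delta>" and card_le: "\<And>\<rho>. \<rho> \<in> \<Delta> \<Longrightarrow> card \<rho> \<le> n"
    and n: "complex_dim \<Delta> = int n - 1"
  shows "h_poly \<Delta> = (\<Sum>\<rho>\<in>\<Delta>. ([:0, 1:] - 1) ^ (n - card \<rho>))"
proof -
  have x: "[:0, 1:] - 1 = ([:-1, 1:] :: int poly)"
    by (simp add: one_pCons)
  have "(\<Sum>\<rho>\<in>\<Delta>. [:-1, 1:] ^ (n - card \<rho>)) =
        (\<Sum>i\<le>n. \<Sum>\<rho> | \<rho> \<in> \<Delta> \<and> card \<rho> = i. [:-1, 1:] ^ (n - card \<rho>) :: int poly)"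
    using assms by (intro sum.group[symmetric]) auto
  also have "\<dots> = (\<Sum>i\<le>n. smult (int (f_number \<Delta> (int i - 1))) ([:-1, 1:] ^ (n - i)))"
    by (intro sum.cong) (auto simp: f_number_def face_dim_def of_nat_poly)
  also have "\<dots> = h_poly \<Delta>"
    using n by (simp add: h_poly_def Let_def)
  finally show ?thesis
    by (simp add: x)
qed

lemma pure_complex_facets:
  assumes "pure_complex d \<Delta>"
  shows "\<And>\<rho>. \<rho> \<in> \<Delta> \<Longrightarrow> int (card \<rho>) \<le> d + 1"
    and "\<And>\<tau>. \<tau> \<in> facets \<Delta> \<Longrightarrow> int (card \<tau>) = d + 1"
proof -
  have sc: "finite \<Delta>" "\<And>\<sigma>. \<sigma> \<in> \<Delta> \<Longrightarrow> finite \<sigma>" and ne: "\<Delta> \<noteq> {}"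
    and d: "d = Max (face_dim ` \<Delta>)"
    and pure: "\<And>F G. F \<in> facets \<Delta> \<Longrightarrow> G \<in> facets \<Delta> \<Longrightarrow> face_dim F = face_dim G"
    using assms unfolding pure_complex_def simplicial_complex_def complex_dim_def by blast+
  have le: "face_dim \<rho> \<le> d" if "\<rho> \<in> \<Delta>" for \<rho>
    using sc that unfolding d by (intro Max_ge) auto
  then show "int (card \<rho>) \<le> d + 1" if "\<rho> \<in> \<Delta>" for \<rho>
    using that by (force simp: face_dim_def)
  \<comment> \<open>A face attaining the maximal dimension is a facet, and purity passes its size to all others.\<close>
  have "d \<in> face_dim ` \<Delta>"
    unfolding d using sc ne by (intro Max_in) auto
  then obtain \<mu> where \<mu>: "\<mu> \<in> \<Delta>" "face_dim \<mu> = d"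
    by auto
  have "\<mu> \<in> facets \<Delta>"
    unfolding maximal_elements_def
  proof (intro CollectI conjI ballI impI \<mu>(1))
    fix \<rho> assume \<rho>: "\<rho> \<in> \<Delta>" "\<mu> \<subseteq> \<rho>"
    have "card \<rho> \<le> card \<mu>"
      using le[OF \<rho>(1)] \<mu>(2) by (simp add: face_dim_def)
    then show "\<rho> = \<mu>"
      using sc(2)[OF \<rho>(1)] \<rho>(2) by (metis card_seteq)
  qed
  then show "int (card \<tau>) = d + 1" if "\<tau> \<in> facets \<Delta>" for \<tau>
    using pure[OF that] \<mu> by (simp add: face_dim_def)
qed

text \<open>
  A down-closed family contains nothing above a face outside it, so removing it cannot turn
  a non-maximal face into a maximal one.
\<close>

lemma maximal_elements_relative_complex:
  assumes "simplicial_complex \<Delta>"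
  shows "maximal_elements (relative_complex \<Gamma> \<Delta>) \<subseteq> facets \<Gamma>"
  using assms unfolding maximal_elements_def relative_complex_def simplicial_complex_def
  by blast

lemma coeff_sum_bottoms:
  assumes "finite \<I>" "\<And>I. I \<in> \<I> \<Longrightarrow> card (bottom I) \<le> n" "i \<le> n"
  shows "coeff (\<Sum>I\<in>\<I>. [:0, 1:] ^ (n - card (bottom I)) :: int poly) (n - i) =
    int (card {I \<in> \<I>. card (bottom I) = i})"
proof -
  have x: "[:0, 1:] ^ k = monom (1 :: int) k" for k
    by (simp add: monom_altdef)
  have "coeff (\<Sum>I\<in>\<I>. [:0, 1:] ^ (n - card (bottom I)) :: int poly) (n - i) =
    (\<Sum>I\<in>\<I>. if card (bottom I) = i then 1 else 0)"
    unfolding coeff_sum x coeff_monom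
  proof (rule sum.cong[OF refl])
    fix I assume "I \<in> \<I>"
    \<comment> \<open>Truncated subtraction from \<open>n\<close> is injective only on sizes up to \<open>n\<close>.\<close>
    then have "n - card (bottom I) = n - i \<longleftrightarrow> card (bottom I) = i"
      using assms(2)[of I] assms(3) by linarith
    then show "(if n - card (bottom I) = n - i then 1 else 0) =
        (if card (bottom I) = i then 1 else (0::int))"
      by simp
  qed
  also have "\<dots> = int (card {I \<in> \<I>. card (bottom I) = i})"
    using assms(1) by (simp add: sum.If_cases Int_def)
  finally show ?thesis .
qed

lemma partitioning_finite_bottom:
  assumes "partitioning P \<I>" "finite P"
  shows "finite \<I>" and "\<And>I. I \<in> \<I> \<Longrightarrow> bottom I \<in> P"
proof -
  have "\<I> \<subseteq> Pow P"
    using assms(1) by (auto simp: partitioning_def partition_on_def)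
  then show "finite \<I>"
    using assms(2) finite_subset by blast
  show "bottom I \<in> P" if "I \<in> \<I>" for I
    using assms(1) that unfolding partitioning_def by (metis bottom_interval)
qed

theorem corollary4p2:
  fixes \<Delta> \<Gamma> :: "'a set set" and d :: int and i :: nat
    and \<I> \<J> :: "'a set set set"
  assumes "pure_complex d \<Delta>"
    and "partition_extender d \<Delta> \<Gamma>"
    and "int i \<le> d + 1"
    and "partitioning \<Gamma> \<I>"
    and "partitioning (relative_complex \<Gamma> \<Delta>) \<J>"
  shows "h_vector \<Delta> i =
    int (card {I \<in> \<I>. card (bottom I) = i}) - int (card {J \<in> \<J>. card (bottom J) = i})"
proof -
  let ?R = "relative_complex \<Gamma> \<Delta>" and ?x = "[:0, 1:] :: int poly"
  define n where "n = nat (d + 1)"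
  have n: "d + 1 = int n" "i \<le> n"
    using assms(3) by (auto simp: n_def)
  have \<Gamma>: "pure_complex d \<Gamma>" and sub: "\<Delta> \<subseteq> \<Gamma>"
    using assms(2) by (auto simp: partition_extender_def)
  have sc\<Delta>: "simplicial_complex \<Delta>" and sc\<Gamma>: "simplicial_complex \<Gamma>"
    and dim: "complex_dim \<Delta> = d"
    using assms(1) \<Gamma> by (auto simp: pure_complex_def)
  have finP: "finite \<Gamma>" "finite ?R" "finite \<Delta>"
    using sc\<Gamma> sc\<Delta> by (auto simp: simplicial_complex_def relative_complex_def)
  have card_le: "card \<rho> \<le> n" if "\<rho> \<in> \<Gamma>" for \<rho>
    using pure_complex_facets(1)[OF \<Gamma> that] n by simp
  have facet: "card \<tau> = n" if "\<tau> \<in> facets \<Gamma>" for \<tau>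
    using pure_complex_facets(2)[OF \<Gamma> that] n by simp
  have w\<Gamma>: "(\<Sum>\<rho>\<in>\<Gamma>. (?x - 1) ^ (n - card \<rho>)) = (\<Sum>I\<in>\<I>. ?x ^ (n - card (bottom I)))"
    by (rule sum_partitioning[OF finP(1) _ _ _ assms(4)])
       (use sc\<Gamma> facet in \<open>auto simp: simplicial_complex_def\<close>)
  have wR: "(\<Sum>\<rho>\<in>?R. (?x - 1) ^ (n - card \<rho>)) = (\<Sum>J\<in>\<J>. ?x ^ (n - card (bottom J)))"
  proof (rule sum_partitioning[OF finP(2) _ _ _ assms(5)])
    show "finite \<sigma>" if "\<sigma> \<in> ?R" for \<sigma>
      using sc\<Gamma> that by (auto simp: simplicial_complex_def relative_complex_def)
    \<comment> \<open>\<open>\<rho>\<close> lies in \<open>\<Gamma>\<close> because \<open>\<tau>\<close> does, and outside \<open>\<Delta>\<close> because \<open>\<sigma>\<close> is outside.\<close>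
    show "\<rho> \<in> ?R" if "\<sigma> \<in> ?R" "\<tau> \<in> ?R" "\<sigma> \<subseteq> \<rho>" "\<rho> \<subseteq> \<tau>" for \<sigma> \<rho> \<tau>
      using sc\<Gamma> sc\<Delta> that unfolding simplicial_complex_def relative_complex_def by blast
    show "card \<tau> = n" if "\<tau> \<in> maximal_elements ?R" for \<tau>
      using that facet maximal_elements_relative_complex[OF sc\<Delta>] by blast
  qed
  have "h_poly \<Delta> = (\<Sum>\<rho>\<in>\<Delta>. (?x - 1) ^ (n - card \<rho>))"
    using finP sub card_le dim n by (intro h_poly_eq_sum_faces) auto
  also have "\<dots> = (\<Sum>\<rho>\<in>\<Gamma>. (?x - 1) ^ (n - card \<rho>)) - (\<Sum>\<rho>\<in>?R. (?x - 1) ^ (n - card \<rho>))"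
    using sum_diff[OF finP(1) sub, of "\<lambda>\<rho>. (?x - 1) ^ (n - card \<rho>)"]
    by (simp add: relative_complex_def)
  finally have h: "h_poly \<Delta> =
      (\<Sum>I\<in>\<I>. ?x ^ (n - card (bottom I))) - (\<Sum>J\<in>\<J>. ?x ^ (n - card (bottom J)))"
    by (simp only: w\<Gamma> wR)
  have "card (bottom I) \<le> n" if "I \<in> \<I>" for I
    using partitioning_finite_bottom(2)[OF assms(4) finP(1) that] card_le by blast
  moreover have "card (bottom J) \<le> n" if "J \<in> \<J>" for J
    using partitioning_finite_bottom(2)[OF assms(5) finP(2) that] card_le
    by (auto simp: relative_complex_def)
  moreover have "h_vector \<Delta> i = coeff (h_poly \<Delta>) (n - i)"
    by (simp add: h_vector_def dim n)
  ultimately show ?thesis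
    using coeff_sum_bottoms[OF partitioning_finite_bottom(1)[OF assms(4) finP(1)] _ n(2)]
      coeff_sum_bottoms[OF partitioning_finite_bottom(1)[OF assms(5) finP(2)] _ n(2)]
    by (simp only: h coeff_diff)
qed

end
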